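(* Every connected graph $G$ with radius $r(G)\le 2$ admits an antimagic orientation.
   Context: All graphs are finite and simple. For a connected graph $G$, $d_G(x,y)$ is the length of a shortest path between $x$ and $y$, and the radius of $G$ is $r(G):=\min_{x\in V(G)}\max_{y\in V(G)} d_G(x,y)$. For a digraph $D$ with $m$ arcs, arc set $A(D)$, and a bijection $\tau:A(D)\to\{1,2,\ldots,m\}$, the vertex-sum $s_{(D,\tau)}(u)$ of a vertex $u$ is the sum of the labels of all arcs entering $u$ minus the sum of the labels of all arcs leaving $u$ (and $s_{(D,\tau)}(u):=0$ if $u$ is isolated). The bijection $\tau$ is an antimagic labeling of $D$ if $s_{(D,\tau)}(u)\ne s_{(D,\tau)}(v)$ for all distinct vertices $u,v$ of $D$. An antimagic orientation of a graph $G$ is a pair $(D,\tau)$ where $D$ is an orientation of $G$ (each edge of $G$ is replaced by exactly one of its two possible arcs) and $\tau$ is an antimagic labeling of $D$. *)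

theory Defs
  imports "Graph_Theory.Graph_Theory"
begin

text \<open>
  A finite simple graph is a \<^locale>\<open>pair_graph\<close>: a finite loop-free digraph whose arcs are pairs
  of vertices and whose arc set is symmetric, so that an edge \<open>uv\<close> is the pair of opposite arcs
  \<open>(u,v)\<close>, \<open>(v,u)\<close>. The coercion \<^const>\<open>with_proj\<close> views it as a \<open>pre_digraph\<close>.
\<close>

text \<open>
  The distance is meaningful only if \<open>v\<close> is reachable from \<open>u\<close>, since \<open>LEAST\<close> is
  unspecified on an empty set.
\<close>

definition graph_dist :: "('a, 'b) pre_digraph \<Rightarrow> 'a \<Rightarrow> 'a \<Rightarrow> nat" where
  "graph_dist G u v = (LEAST n. \<exists>p. pre_digraph.apath G u p v \<and> length p = n)"

definition graph_radius :: "('a, 'b) pre_digraph \<Rightarrow> nat" where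
  "graph_radius G = (MIN x\<in>verts G. MAX y\<in>verts G. graph_dist G x y)"

definition orientation_of :: "'a pair_pre_digraph \<Rightarrow> 'a pair_pre_digraph \<Rightarrow> bool" where
  "orientation_of D G \<longleftrightarrow>
     pverts D = pverts G \<and> parcs D \<subseteq> parcs G \<and>
     (\<forall>(u, v)\<in>parcs G. ((u, v) \<in> parcs D) \<noteq> ((v, u) \<in> parcs D))"

text \<open>At an isolated vertex both sums are empty, so the value is \<open>0\<close>.\<close>

definition vertex_sum :: "('a, 'b) pre_digraph \<Rightarrow> ('b \<Rightarrow> nat) \<Rightarrow> 'a \<Rightarrow> int" where
  "vertex_sum D \<tau> u = (\<Sum>a\<in>in_arcs D u. int (\<tau> a)) - (\<Sum>a\<in>out_arcs D u. int (\<tau> a))"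

definition antimagic_labeling :: "('a, 'b) pre_digraph \<Rightarrow> ('b \<Rightarrow> nat) \<Rightarrow> bool" where
  "antimagic_labeling D \<tau> \<longleftrightarrow>
     bij_betw \<tau> (arcs D) {1..card (arcs D)} \<and>
     (\<forall>u\<in>verts D. \<forall>v\<in>verts D. u \<noteq> v \<longrightarrow> vertex_sum D \<tau> u \<noteq> vertex_sum D \<tau> v)"

definition antimagic_orientation ::
    "'a pair_pre_digraph \<Rightarrow> 'a pair_pre_digraph \<Rightarrow> ('a \<times> 'a \<Rightarrow> nat) \<Rightarrow> bool" where
  "antimagic_orientation G D \<tau> \<longleftrightarrow> orientation_of D G \<and> antimagic_labeling D \<tau>"

end

theory Submission
  imports Defs
begin

text \<open>
  Let \<open>x\<close> be a vertex at distance at most \<open>2\<close> from all others, let \<open>A\<close> be its neighbourhood and \<open>B\<close>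
  the set of vertices at distance exactly \<open>2\<close>. Every vertex of \<open>A\<close> is adjacent to \<open>x\<close> and every
  vertex of \<open>B\<close> has a neighbour in \<open>A\<close>. The labelling makes all vertex sums positive on \<open>A\<close> and
  negative on \<open>B \<union> {x}\<close>, and separates the vertices inside each of the two classes. (If \<open>A\<close> is empty,
  \<open>x\<close> is the only vertex.)

  Signs. The \<open>h\<close> edges inside \<open>A\<close> and inside \<open>B\<close> receive the labels \<open>1, \<dots>, h\<close>. Lemma
  \<open>bounded_sum_orientation\<close> orients and labels them so that they contribute at most \<open>h\<close> to every
  vertex sum; reversing the arcs inside \<open>A\<close> turns this into a contribution of at least \<open>-h\<close> there.
  The edges between \<open>B \<union> {x}\<close> and \<open>A\<close> are all directed towards \<open>A\<close> and have labels larger than \<open>h\<close>,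
  so a single one of them decides the sign of the sum at each of its ends.

  Separation. Up to the sign on \<open>B \<union> {x}\<close>, each of these crossing edges adds its label to the sum at
  both of its ends. Lemma \<open>bipartite_labelling\<close> chooses one crossing edge at every vertex of \<open>B\<close> and
  treats the star at \<open>x\<close> separately; the crossing edges of neither kind take the smallest labels
  available. The chosen edges and one edge of the star take the next labels, and the rest of the star
  the largest ones. The labels of the middle group are distributed over \<open>B \<union> {x}\<close> so that a vertex
  whose other labels have a larger sum gets a larger label (lemma \<open>sorted_assignment\<close>). Here \<open>x\<close> takes
  part like a vertex of \<open>B\<close>, since its sum depends only on the set of labels on its star and not on
  the way they are distributed. The distribution of this set over \<open>A\<close> is therefore still free, and
  sorting once more separates the vertices of \<open>A\<close>.
\<close>

section \<open>Orientations and arc lists with descending labels\<close>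

text \<open>
  The undirected graph is given by a symmetric relation \<open>E\<close>. The equation with \<open>E\<close> makes orientations
  of edge-disjoint graphs composable by union; the second conjunct also excludes loops.
\<close>

definition orients :: "('a \<times> 'a) set \<Rightarrow> ('a \<times> 'a) set \<Rightarrow> bool" where
  "orients D E \<longleftrightarrow> D \<union> D\<inverse> = E \<and> D \<inter> D\<inverse> = {}"

lemma orients_Un:
  assumes "orients D E" "orients D' E'" "E \<inter> E' = {}"
  shows "orients (D \<union> D') (E \<union> E')"
proof -
  have "D \<subseteq> E" "D\<inverse> \<subseteq> E" "D' \<subseteq> E'" "D'\<inverse> \<subseteq> E'" using assms(1,2) by (auto simp: orients_def)
  then have "D \<inter> D'\<inverse> = {}" "D' \<inter> D\<inverse> = {}" using assms(3) by blast+
  then show ?thesis using assms(1,2) by (auto simp: orients_def converse_Un)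
qed

text \<open>
  In-label minus out-label at \<open>u\<close> when the arcs of the list carry the labels
  \<open>a + 1, \<dots>, a + length xs\<close>, the largest at the head of the list. The offset \<open>a\<close> makes room for
  further arcs with smaller labels.
\<close>

fun arcs_sum :: "nat \<Rightarrow> ('a \<times> 'a) list \<Rightarrow> 'a \<Rightarrow> int" where
  "arcs_sum a [] u = 0"
| "arcs_sum a ((v, w) # xs) u =
     int (a + length xs + 1) * (of_bool (u = w) - of_bool (u = v)) + arcs_sum a xs u"

lemma arcs_sum_append:
  "arcs_sum a (xs @ ys) u = arcs_sum (a + length ys) xs u + arcs_sum a ys u"
  by (induction xs) (auto simp: algebra_simps)

lemma arcs_sum_swap: "arcs_sum a (map prod.swap xs) u = - arcs_sum a xs u"
  by (induction xs) (auto simp: algebra_simps)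

lemma arcs_sum_eq_0: "u \<notin> Field (set xs) \<Longrightarrow> arcs_sum a xs u = 0"
  by (induction a xs u rule: arcs_sum.induct) auto

text \<open>
  The arcs run against the walk: along a walk \<open>v\<^sub>0, v\<^sub>1, \<dots>\<close>, the largest label enters \<open>v\<^sub>0\<close>, and
  each inner vertex first emits a label and then receives the next smaller one.
\<close>

fun walk_arcs :: "'a list \<Rightarrow> ('a \<times> 'a) list" where
  "walk_arcs (v # w # p) = (w, v) # walk_arcs (w # p)"
| "walk_arcs p = []"

lemma length_walk_arcs: "length (walk_arcs p) = length p - 1"
  by (induction p rule: walk_arcs.induct) auto

lemma map_fst_walk_arcs: "map fst (walk_arcs p) = tl p"
  by (induction p rule: walk_arcs.induct) auto

lemma walk_arcs_subset: "set (walk_arcs p) \<subseteq> set p \<times> set p"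
  by (induction p rule: walk_arcs.induct) auto

lemma walk_arcs_snoc: "p \<noteq> [] \<Longrightarrow> walk_arcs (p @ [v]) = walk_arcs p @ [(v, last p)]"
  by (induction p rule: walk_arcs.induct) auto

lemma walk_arcs_in:
  assumes "successively (\<lambda>u v. (u, v) \<in> E) p" "sym E"
  shows "set (walk_arcs p) \<subseteq> E"
  using assms by (induction p rule: walk_arcs.induct) (auto dest: symD)

lemma walk_arcs_antisym:
  assumes "distinct p" "(u, v) \<in> set (walk_arcs p)"
  shows "(v, u) \<notin> set (walk_arcs p)"
  using assms
proof (induction p rule: walk_arcs.induct)
  case (1 x w p)
  then show ?case using walk_arcs_subset[of "w # p"] by auto
qed auto

text \<open>
  The labels telescope: passing through an inner vertex of the walk contributes \<open>-1\<close>, so only the two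
  ends matter. Repeated vertices are harmless, which allows closed walks.
\<close>

lemma arcs_sum_walk:
  assumes "length p \<ge> 2"
  shows "arcs_sum a (walk_arcs p) u
    \<le> int (a + length p - 1) * of_bool (u = hd p) - int (a + 1) * of_bool (u = last p)"
  using assms
proof (induction p rule: walk_arcs.induct)
  case (1 v w p)
  show ?case
  proof (cases p)
    case Nil
    then show ?thesis by auto
  next
    case (Cons z q)
    then have "arcs_sum a (walk_arcs (w # p)) u
        \<le> int (a + length p) * of_bool (u = w) - int (a + 1) * of_bool (u = last (w # p))"
      using "1.IH" by simp
    then show ?thesis by (cases "u = w"; cases "u = v") (simp_all add: length_walk_arcs Cons)
  qed
qed auto

section \<open>Orientations with bounded vertex sums\<close>

text \<open>
  The first vertex of a longest path has a neighbour besides the second vertex. By maximality it lies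
  on the path, so it closes a cycle.
\<close>

lemma exists_cycle:
  assumes fin: "finite E" and sym: "sym E" and irr: "irrefl E" and ne: "E \<noteq> {}"
    and noleaf: "\<And>u v. (u, v) \<in> E \<Longrightarrow> \<exists>w. w \<noteq> u \<and> (v, w) \<in> E"
  shows "\<exists>p. length p \<ge> 3 \<and> distinct p \<and> successively (\<lambda>u v. (u, v) \<in> E) p \<and> (last p, hd p) \<in> E"
proof -
  define P where "P p \<longleftrightarrow> distinct p \<and> successively (\<lambda>u v. (u, v) \<in> E) p \<and> set p \<subseteq> Field E" for p
  obtain a b where ab: "(a, b) \<in> E" using ne by auto
  then have Pab: "P [a, b]" using irr by (auto simp: P_def irrefl_def Field_def)
  have "\<forall>p. P p \<longrightarrow> length p < Suc (card (Field E))"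
    using fin by (auto simp: P_def less_Suc_eq_le finite_Field intro!: card_mono
        simp flip: distinct_card)
  from ex_has_greatest_nat[of P "[a, b]" length, OF Pab this]
  obtain p where p: "P p" and max: "\<And>q. P q \<Longrightarrow> length q \<le> length p" by blast
  have "length p \<ge> 2" using max[OF Pab] by simp
  then obtain v w q where pq: "p = v # w # q"
    by (metis Suc_le_length_iff numeral_2_eq_2)
  have "(w, v) \<in> E" using p sym by (auto simp: P_def pq dest: symD)
  then obtain z where z: "z \<noteq> w" "(v, z) \<in> E" using noleaf by blast
  have "z \<in> set p"
  proof (rule ccontr)
    assume "z \<notin> set p"
    then have "P (z # p)" using p z sym by (auto simp: P_def pq Field_def dest: symD)
    then show False using max by fastforce
  qed
  moreover have "z \<noteq> v" using z irr by (auto simp: irrefl_def)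
  ultimately have "z \<in> set q" using z pq by auto
  then obtain q1 q2 where q: "q = q1 @ z # q2" by (meson split_list)
  have pq2: "p = (v # w # q1 @ [z]) @ q2" by (simp add: pq q)
  have "distinct (v # w # q1 @ [z])" "successively (\<lambda>u v. (u, v) \<in> E) (v # w # q1 @ [z])"
    using p unfolding P_def pq2 by (auto simp: successively_append_iff simp del: append_Cons)
  then show ?thesis using z sym by (intro exI[of _ "v # w # q1 @ [z]"]) (auto dest: symD)
qed

text \<open>
  Edges are removed from the graph and given the largest remaining labels. If there is a leaf, its
  edge is directed into it: the leaf then has no further arcs, and the sum at the other end only
  decreases. Otherwise there is a cycle. If it is directed against the order of its descending
  labels, it contributes \<open>-1\<close> to all its vertices but one, at which the largest label enters and the
  smallest leaves. The difference of these two is one less than the length of the cycle, whereas the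
  bound grows by that length.
\<close>

lemma bounded_sum_orientation:
  assumes "finite E" "sym E" "irrefl E"
  shows "\<exists>xs. distinct xs \<and> orients (set xs) E \<and> (\<forall>u. arcs_sum a xs u \<le> int (a + length xs))"
  using assms
proof (induction "card E" arbitrary: E rule: less_induct)
  case less
  note fin = less.prems(1) and sym = less.prems(2) and irr = less.prems(3)
  have IH: "\<exists>xs. distinct xs \<and> orients (set xs) (E - C) \<and> (\<forall>u. arcs_sum a xs u \<le> int (a + length xs))"
    if "C \<subseteq> E" "C \<noteq> {}" "sym C" for C
    using that fin sym irr
    by (intro less.hyps psubset_card_mono) (auto simp: sym_def irrefl_def)
  consider "E = {}"
    | u v where "(u, v) \<in> E" "\<And>w. (v, w) \<in> E \<Longrightarrow> w = u"
    | "E \<noteq> {}" "\<And>u v. (u, v) \<in> E \<Longrightarrow> \<exists>w. w \<noteq> u \<and> (v, w) \<in> E" by blast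
  then show ?case
  proof cases
    case 1
    then show ?thesis by (intro exI[of _ "[]"]) (auto simp: orients_def)
  next
    case 2
    have "(v, u) \<in> E" "u \<noteq> v" using 2 sym irr by (auto simp: irrefl_def dest: symD)
    then have "{(u, v), (v, u)} \<subseteq> E" "sym {(u, v), (v, u)}" using 2(1) by (auto simp: sym_def)
    from IH[OF this(1) _ this(2)]
    obtain xs where xs: "distinct xs" "orients (set xs) (E - {(u, v), (v, u)})"
      and le: "\<And>y. arcs_sum a xs y \<le> int (a + length xs)"
      by blast
    have or1: "orients {(u, v)} {(u, v), (v, u)}" using \<open>u \<noteq> v\<close> by (auto simp: orients_def)
    have "orients (set ((u, v) # xs)) E"
      using orients_Un[OF or1 xs(2)] 2(1) \<open>(v, u) \<in> E\<close> by (simp add: insert_absorb)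
    moreover have "(u, v) \<notin> set xs" using xs(2) by (auto simp: orients_def)
    moreover have "v \<notin> Field (set xs)"
    proof
      assume "v \<in> Field (set xs)"
      then obtain w where "(v, w) \<in> set xs \<union> (set xs)\<inverse>" by (auto simp: Field_def)
      then show False using xs(2) 2(2)[of w] by (auto simp: orients_def)
    qed
    then have "arcs_sum a xs v = 0" by (rule arcs_sum_eq_0)
    then have "arcs_sum a ((u, v) # xs) y \<le> int (a + length ((u, v) # xs))" for y
      using le[of y] by (cases "y = v"; cases "y = u") auto
    ultimately show ?thesis using xs(1) by (intro exI[of _ "(u, v) # xs"]) auto
  next
    case 3
    then obtain p where p: "length p \<ge> 3" "distinct p" "successively (\<lambda>u v. (u, v) \<in> E) p"
      "(last p, hd p) \<in> E" using exists_cycle[OF fin sym irr] by blast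
    then obtain v w q where pq: "p = v # w # q" "q \<noteq> []"
      by (cases p; cases "tl p"; cases "tl (tl p)") auto
    define ys where "ys = walk_arcs (p @ [hd p])"
    have ys: "ys = walk_arcs p @ [(v, last p)]" using pq walk_arcs_snoc[of p v] by (simp add: ys_def)
    have "distinct (map fst ys)" using p(2) by (auto simp: ys_def map_fst_walk_arcs pq(1))
    then have dys: "distinct ys" by (simp add: distinct_map)
    have "successively (\<lambda>u v. (u, v) \<in> E) (p @ [hd p])"
      using p(1,3,4) by (simp add: successively_append_iff)
    then have ysE: "set ys \<subseteq> E" unfolding ys_def using sym by (rule walk_arcs_in)
    have v: "v \<notin> set (w # q)" and l: "last p \<noteq> v" "last p \<noteq> w"
      using p(2) pq(2) last_in_set[of q] by (auto simp: pq(1))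
    have "(last p, v) \<notin> set (walk_arcs (w # q))" using v walk_arcs_subset[of "w # q"] by blast
    then have "(last p, v) \<notin> set (walk_arcs p)" using l by (simp add: pq(1))
    \<comment> \<open>a cycle has at least three vertices, so the closing arc does not reverse an arc of the path\<close>
    then have "(y, x) \<notin> set ys" if "(x, y) \<in> set ys" for x y
      using that walk_arcs_antisym[OF p(2)] l by (auto simp: ys)
    then have or1: "orients (set ys) (set ys \<union> (set ys)\<inverse>)" by (auto simp: orients_def)
    have subE: "set ys \<union> (set ys)\<inverse> \<subseteq> E" using ysE sym by (auto dest: symD)
    have "set ys \<union> (set ys)\<inverse> \<noteq> {}" by (simp add: ys)
    from IH[OF subE this sym_Un_converse]
    obtain xs where xs: "distinct xs" "orients (set xs) (E - (set ys \<union> (set ys)\<inverse>))"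
      and le: "\<And>y. arcs_sum a xs y \<le> int (a + length xs)" by blast
    have "set ys \<union> (set ys)\<inverse> \<union> (E - (set ys \<union> (set ys)\<inverse>)) = E" using subE by blast
    then have "orients (set (ys @ xs)) E" using orients_Un[OF or1 xs(2)] by simp
    moreover have "set xs \<inter> set ys = {}" using xs(2) unfolding orients_def by blast
    then have "distinct (ys @ xs)" using dys xs(1) by auto
    moreover have "arcs_sum a (ys @ xs) y \<le> int (a + length (ys @ xs))" for y
    proof -
      have "arcs_sum (a + length xs) ys y \<le> int (length ys)"
        using arcs_sum_walk[of "p @ [hd p]" "a + length xs" y]
        by (cases "y = v") (auto simp: ys_def length_walk_arcs pq(1))
      then show ?thesis using le[of y] by (simp add: arcs_sum_append)
    qed
    ultimately show ?thesis by blast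
  qed
qed

section \<open>Vertex sums of labelled arc sets\<close>

definition in_out_sum :: "('a \<times> 'a) set \<Rightarrow> ('a \<times> 'a \<Rightarrow> nat) \<Rightarrow> 'a \<Rightarrow> int" where
  "in_out_sum D \<tau> u = (\<Sum>e | e \<in> D \<and> snd e = u. int (\<tau> e)) - (\<Sum>e | e \<in> D \<and> fst e = u. int (\<tau> e))"

lemma vertex_sum_pair: "vertex_sum (with_proj D) \<tau> u = in_out_sum (parcs D) \<tau> u"
  by (simp add: vertex_sum_def in_out_sum_def in_arcs_def out_arcs_def)

lemma in_out_sum_cong: "(\<And>e. e \<in> D \<Longrightarrow> \<tau> e = \<tau>' e) \<Longrightarrow> in_out_sum D \<tau> u = in_out_sum D \<tau>' u"
  unfolding in_out_sum_def by (intro arg_cong2[where f=minus] sum.cong) auto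

lemma in_out_sum_Un:
  assumes "finite D" "finite D'" "D \<inter> D' = {}"
  shows "in_out_sum (D \<union> D') \<tau> u = in_out_sum D \<tau> u + in_out_sum D' \<tau> u"
proof -
  have "(\<Sum>e | e \<in> D \<union> D' \<and> Q e. int (\<tau> e)) =
    (\<Sum>e | e \<in> D \<and> Q e. int (\<tau> e)) + (\<Sum>e | e \<in> D' \<and> Q e. int (\<tau> e))" for Q
    using assms by (subst sum.union_disjoint [symmetric]) (auto intro!: sum.cong)
  from this[of "\<lambda>e. snd e = u"] this[of "\<lambda>e. fst e = u"] show ?thesis unfolding in_out_sum_def by simp
qed

lemma labelling_of_list:
  assumes "distinct xs"
  shows "\<exists>\<tau>. bij_betw \<tau> (set xs) {1..length xs} \<and> (\<forall>u. in_out_sum (set xs) \<tau> u = arcs_sum 0 xs u)"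
  using assms
proof (induction xs)
  case Nil
  then show ?case by (auto simp: in_out_sum_def bij_betw_def)
next
  case (Cons e xs)
  then obtain \<tau> where bij: "bij_betw \<tau> (set xs) {1..length xs}"
    and s: "\<And>u. in_out_sum (set xs) \<tau> u = arcs_sum 0 xs u" by auto
  obtain v w where e: "e = (v, w)" by fastforce
  define \<tau>' where "\<tau>' = \<tau>(e := Suc (length xs))"
  have "bij_betw \<tau>' (set xs) {1..length xs}"
    using bij Cons.prems by (subst bij_betw_cong[of _ _ \<tau>]) (auto simp: \<tau>'_def)
  then have "bij_betw \<tau>' (set xs \<union> {e}) ({1..length xs} \<union> {Suc (length xs)})"
    by (rule bij_betw_combine) (auto simp: \<tau>'_def)
  moreover have "in_out_sum ({e} \<union> set xs) \<tau>' u = arcs_sum 0 (e # xs) u" for u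
  proof -
    have "in_out_sum (set xs) \<tau>' u = in_out_sum (set xs) \<tau> u"
      using Cons.prems by (intro in_out_sum_cong) (auto simp: \<tau>'_def)
    moreover have "{f. f = e \<and> Q f} = (if Q e then {e} else {})" for Q by auto
    then have "in_out_sum {e} \<tau>' u = int (Suc (length xs)) * (of_bool (u = w) - of_bool (u = v))"
      by (simp add: in_out_sum_def \<tau>'_def e)
    ultimately show ?thesis using Cons.prems s by (subst in_out_sum_Un) (auto simp: e)
  qed
  ultimately show ?case
    by (intro exI[of _ \<tau>']) (simp add: atLeastAtMostSuc_conv Un_insert_right)
qed

section \<open>Separating the vertex sums\<close>

text \<open>
  Assign the labels in the order of the values of \<open>p\<close>; the sums are then strictly increasing. The
  induction gives the largest label to an element with the largest value.
\<close>

lemma sorted_assignment: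
  fixes p :: "'a \<Rightarrow> int" and L :: "nat set"
  assumes "finite W" "finite L" "card W = card L"
  shows "\<exists>g. bij_betw g W L \<and> inj_on (\<lambda>w. p w + int (g w)) W"
  using assms
proof (induction "card W" arbitrary: W L)
  case 0
  then show ?case by (auto simp: bij_betw_def)
next
  case (Suc n)
  then have "W \<noteq> {}" "L \<noteq> {}" by auto
  then obtain w where w: "w \<in> W" "\<And>v. v \<in> W \<Longrightarrow> p v \<le> p w"
    using Suc.prems(1) obtains_MAX[of W p] by (metis Max_ge finite_imageI imageI)
  define l where "l = Max L"
  have l: "l \<in> L" "\<And>k. k \<in> L \<Longrightarrow> k \<le> l" using \<open>L \<noteq> {}\<close> Suc.prems by (auto simp: l_def)
  obtain g where g: "bij_betw g (W - {w}) (L - {l})" "inj_on (\<lambda>w. p w + int (g w)) (W - {w})"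
    using Suc.hyps(1)[of "W - {w}" "L - {l}"] Suc.hyps(2) Suc.prems w(1) l(1)
    by (metis card_Diff_singleton diff_Suc_1 finite_Diff)
  define g' where "g' = g(w := l)"
  have "bij_betw g' (W - {w}) (L - {l})"
    using g(1) by (subst bij_betw_cong[of _ _ g]) (auto simp: g'_def)
  then have "bij_betw g' (W - {w} \<union> {w}) (L - {l} \<union> {l})"
    by (rule bij_betw_combine) (auto simp: g'_def)
  then have "bij_betw g' W L" using w l by (simp add: insert_absorb)
  moreover have "p v + int (g v) < p w + int l" if "v \<in> W - {w}" for v
  proof -
    have "g v \<in> L - {l}" using g(1) that by (auto simp: bij_betw_def)
    then have "g v < l" using l(2)[of "g v"] by auto
    then show ?thesis using w(2)[of v] that by simp
  qed
  then have "p w + int l \<notin> (\<lambda>v. p v + int (g v)) ` (W - {w})" by fastforce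
  then have "inj_on (\<lambda>v. p v + int (g' v)) (insert w (W - {w}))"
    using g(2) unfolding inj_on_insert by (auto simp: g'_def inj_on_def)
  then have "inj_on (\<lambda>v. p v + int (g' v)) W" using w(1) by (simp add: insert_absorb)
  ultimately show ?case by blast
qed

text \<open>
  The functions \<open>s\<close> and \<open>t\<close> are the sums that the vertices on the two sides have before the crossing
  edges are labelled. The side of \<open>x\<close> is sorted first: how its labels are distributed over the star
  does not change the sum at \<open>x\<close> and can be adapted to \<open>A\<close> afterwards.
\<close>

lemma bipartite_labelling:
  fixes C :: "('b \<times> 'a) set" and s :: "'b \<Rightarrow> int" and t :: "'a \<Rightarrow> int"
  assumes fin: "finite A" "finite B" and ne: "A \<noteq> {}" and x: "x \<notin> B"
    and C: "C \<subseteq> B \<times> A" and cover: "\<And>b. b \<in> B \<Longrightarrow> \<exists>a. (b, a) \<in> C"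
  defines "E \<equiv> C \<union> {x} \<times> A"
  shows "\<exists>\<tau>. bij_betw \<tau> E {h + 1..h + card E}
    \<and> inj_on (\<lambda>b. s b + (\<Sum>e | e \<in> E \<and> fst e = b. int (\<tau> e))) (insert x B)
    \<and> inj_on (\<lambda>a. t a + (\<Sum>e | e \<in> E \<and> snd e = a. int (\<tau> e))) A"
proof -
  obtain f where f: "\<And>b. b \<in> B \<Longrightarrow> (b, f b) \<in> C" using cover by metis
  define F where "F = (\<lambda>b. (b, f b)) ` B"
  define R where "R = C - F"
  have finC: "finite C" using C fin by (meson finite_SigmaI finite_subset)
  have FC: "F \<subseteq> C" using f by (auto simp: F_def)
  define c where "c = h + card R"
  have "card R = card {h + 1..c}" by (simp add: c_def)
  then obtain \<rho> where \<rho>: "bij_betw \<rho> R {h + 1..c}"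
    using finC finite_same_card_bij[of R "{h + 1..c}"] by (auto simp: R_def)
  \<comment> \<open>all labels of the star at \<open>x\<close> except the one that \<open>x\<close> will get in competition with \<open>B\<close>\<close>
  define Top where "Top = {c + card B + 2..c + card B + card A}"
  define p where "p b = s b +
    (if b = x then \<Sum>l\<in>Top. int l else \<Sum>e | e \<in> R \<and> fst e = b. int (\<rho> e))" for b
  have "card (insert x B) = card {c + 1..c + card B + 1}" using fin x by simp
  from sorted_assignment[OF _ _ this, of p] fin
  obtain g where g: "bij_betw g (insert x B) {c + 1..c + card B + 1}"
    and injg: "inj_on (\<lambda>b. p b + int (g b)) (insert x B)"
    by (metis finite_atLeastAtMost finite_insert)
  define \<mu> where "\<mu> e = (if e \<in> R then \<rho> e else g (fst e))" for e
  \<comment> \<open>\<open>g x\<close> is a label for some edge of the star; which edge that is gets decided by \<open>k\<close> below\<close>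
  define q where "q a = t a + (\<Sum>e | e \<in> C \<and> snd e = a. int (\<mu> e))" for a
  have gx: "g x \<in> {c + 1..c + card B + 1}" using g by (auto simp: bij_betw_def)
  then have gxT: "g x \<notin> Top" by (auto simp: Top_def)
  have "card A > 0" using fin ne by (simp add: card_gt_0_iff)
  then have "card A = card (insert (g x) Top)" using gxT by (simp add: Top_def)
  from sorted_assignment[OF fin(1) _ this, of q]
  obtain k where k: "bij_betw k A (insert (g x) Top)"
    and injk: "inj_on (\<lambda>a. q a + int (k a)) A"
    unfolding Top_def by (metis finite_atLeastAtMost finite_insert)
  define \<tau> where "\<tau> e = (if fst e = x then k (snd e) else \<mu> e)" for e
  have CB: "fst e \<in> B" "fst e \<noteq> x" if "e \<in> C" for e using that C x by auto
  have \<tau>R: "\<tau> e = \<rho> e" if "e \<in> R" for e using that CB by (auto simp: \<tau>_def \<mu>_def R_def)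
  have \<tau>F: "\<tau> (b, f b) = g b" if "b \<in> B" for b
    using that x by (auto simp: \<tau>_def \<mu>_def R_def F_def)
  have \<tau>C: "\<tau> e = \<mu> e" if "e \<in> C" for e using that CB by (auto simp: \<tau>_def)
  have gB: "g ` B = {c + 1..c + card B + 1} - {g x}" "inj_on g B"
    using g x unfolding bij_betw_def by (auto simp: inj_on_def)
  have "bij_betw \<tau> R {h + 1..c}" using \<rho> \<tau>R by (subst bij_betw_cong[of _ _ \<rho>]) auto
  moreover have "bij_betw \<tau> F ({c + 1..c + card B + 1} - {g x})"
    unfolding bij_betw_def
  proof
    show "inj_on \<tau> F" using \<tau>F gB(2) by (auto simp: F_def inj_on_def)
    show "\<tau> ` F = {c + 1..c + card B + 1} - {g x}"
      unfolding gB(1)[symmetric] by (simp add: F_def image_image \<tau>F)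
  qed
  ultimately have "bij_betw \<tau> (R \<union> F) ({h + 1..c} \<union> ({c + 1..c + card B + 1} - {g x}))"
    by (rule bij_betw_combine) auto
  moreover have "bij_betw \<tau> ({x} \<times> A) (insert (g x) Top)"
    unfolding bij_betw_def
  proof
    show "inj_on \<tau> ({x} \<times> A)" using k by (auto simp: \<tau>_def bij_betw_def inj_on_def)
    have "\<tau> ` ({x} \<times> A) = k ` A" by (force simp: \<tau>_def)
    then show "\<tau> ` ({x} \<times> A) = insert (g x) Top" using k by (simp add: bij_betw_def)
  qed
  ultimately have "bij_betw \<tau> (R \<union> F \<union> {x} \<times> A)
    ({h + 1..c} \<union> ({c + 1..c + card B + 1} - {g x}) \<union> insert (g x) Top)"
    by (rule bij_betw_combine) (use gx in \<open>auto simp: Top_def\<close>)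
  moreover have "R \<union> F \<union> {x} \<times> A = E" using FC by (auto simp: R_def E_def)
  moreover have "card E = card R + card B + card A"
  proof -
    have "card F = card B" unfolding F_def by (rule card_image) (auto simp: inj_on_def)
    then have "card C = card R + card B"
      using card_mono[OF finC FC] finite_subset[OF FC finC] FC
      by (simp add: R_def card_Diff_subset)
    moreover have "C \<inter> {x} \<times> A = {}" using C x by auto
    ultimately show ?thesis unfolding E_def using finC fin by (simp add: card_Un_disjoint)
  qed
  moreover have "{h + 1..c} \<union> ({c + 1..c + card B + 1} - {g x}) \<union> insert (g x) Top
      = {h + 1..h + (card R + card B + card A)}"
    using gx \<open>card A > 0\<close> by (auto simp: Top_def c_def)
  ultimately have "bij_betw \<tau> E {h + 1..h + card E}" by simp
  moreover have "s b + (\<Sum>e | e \<in> E \<and> fst e = b. int (\<tau> e)) = p b + int (g b)"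
    if "b \<in> insert x B" for b
  proof (cases "b = x")
    case True
    have "{e. e \<in> E \<and> fst e = x} = Pair x ` A" using C x by (auto simp: E_def)
    then have "(\<Sum>e | e \<in> E \<and> fst e = x. int (\<tau> e)) = (\<Sum>a\<in>A. int (k a))"
      by (simp add: sum.reindex inj_on_def \<tau>_def)
    also have "\<dots> = (\<Sum>l\<in>insert (g x) Top. int l)"
      by (rule sum.reindex_bij_betw[OF k])
    finally show ?thesis using gxT True by (simp add: p_def Top_def)
  next
    case False
    then have b: "b \<in> B" using that by simp
    have "{e. e \<in> E \<and> fst e = b} = insert (b, f b) {e. e \<in> R \<and> fst e = b}"
      using b x f by (auto simp: E_def R_def F_def)
    moreover have "(b, f b) \<notin> R" "finite R" using b finC by (auto simp: R_def F_def)
    ultimately show ?thesis using b False by (simp add: p_def \<tau>R \<tau>F)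
  qed
  then have "inj_on (\<lambda>b. s b + (\<Sum>e | e \<in> E \<and> fst e = b. int (\<tau> e))) (insert x B)"
    using injg inj_on_cong by (metis (no_types, lifting))
  moreover have "t a + (\<Sum>e | e \<in> E \<and> snd e = a. int (\<tau> e)) = q a + int (k a)" if "a \<in> A" for a
  proof -
    have "{e. e \<in> E \<and> snd e = a} = insert (x, a) {e. e \<in> C \<and> snd e = a}"
      using that by (auto simp: E_def)
    moreover have "(x, a) \<notin> C" using C x by auto
    moreover have "\<tau> (x, a) = k a" by (simp add: \<tau>_def)
    ultimately show ?thesis using finC by (simp add: q_def \<tau>C)
  qed
  then have "inj_on (\<lambda>a. t a + (\<Sum>e | e \<in> E \<and> snd e = a. int (\<tau> e))) A"
    using injk inj_on_cong by (metis (no_types, lifting))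
  ultimately show ?thesis by blast
qed

section \<open>Graphs of radius at most two\<close>

lemma antimagic_of_center:
  fixes E :: "('a \<times> 'a) set"
  assumes finE: "finite E" and sym: "sym E" and irr: "irrefl E"
    and radius: "\<And>v. v \<in> V \<Longrightarrow> v = x \<or> (x, v) \<in> E \<or> (\<exists>w. (x, w) \<in> E \<and> (w, v) \<in> E)"
    and wf: "E \<subseteq> V \<times> V" and fin: "finite V" and x: "x \<in> V"
  shows "\<exists>D \<tau>. orients D E \<and> bij_betw \<tau> D {1..card D} \<and> inj_on (in_out_sum D \<tau>) V"
proof (cases "V = {x}")
  case True
  then have "E = {}" using wf irr by (auto simp: irrefl_def)
  then show ?thesis using True by (intro exI[of _ "{}"]) (auto simp: orients_def bij_betw_def)
next
  case False
  define A where "A = {v. (x, v) \<in> E}"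
  define B where "B = V - insert x A"
  define C where "C = E \<inter> B \<times> A"
  define EA where "EA = E \<inter> A \<times> A"
  define EB where "EB = E \<inter> B \<times> B"
  define X where "X = C \<union> {x} \<times> A"
  have AV: "A \<subseteq> V" "x \<notin> A" "finite A" "finite B" "x \<notin> B" "A \<inter> B = {}"
    using wf irr fin by (auto simp: A_def B_def irrefl_def intro: finite_subset)
  have neA: "A \<noteq> {}"
  proof
    assume "A = {}"
    then have "V \<subseteq> {x}" using radius by (auto simp: A_def)
    then show False using False x by auto
  qed
  have V: "V = A \<union> insert x B" using AV x by (auto simp: B_def)
  have finX: "finite X" using AV finE by (auto simp: X_def C_def)
  \<comment> \<open>the edges inside \<open>B\<close> get the labels below those inside \<open>A\<close>, and the latter are reversed\<close>
  obtain xs where xs: "distinct xs" "orients (set xs) EB"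
    and lexs: "\<And>u. arcs_sum 0 xs u \<le> int (length xs)"
    using bounded_sum_orientation[of EB 0] finE sym irr by (auto simp: EB_def sym_def irrefl_def)
  obtain ys where ys: "distinct ys" "orients (set ys) EA"
    and leys: "\<And>u. arcs_sum (length xs) ys u \<le> int (length xs + length ys)"
    using bounded_sum_orientation[of EA "length xs"] finE sym irr
    by (auto simp: EA_def sym_def irrefl_def)
  define zs where "zs = map prod.swap ys @ xs"
  define h where "h = length zs"
  have swap: "set (map prod.swap ys) = (set ys)\<inverse>" by auto
  have ysA: "(set ys)\<inverse> \<subseteq> A \<times> A" "orients ((set ys)\<inverse>) EA"
    using ys(2) by (auto simp: orients_def EA_def)
  have xsB: "set xs \<subseteq> B \<times> B" using xs(2) by (auto simp: orients_def EB_def)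
  have dzs: "distinct zs"
    using ys(1) xs(1) ysA(1) xsB AV(6) unfolding zs_def distinct_append swap
    by (auto simp: distinct_map)
  have "EA \<inter> EB = {}" using AV(6) by (auto simp: EA_def EB_def)
  then have ozs: "orients (set zs) (EA \<union> EB)"
    unfolding zs_def set_append swap using ysA(2) xs(2) by (intro orients_Un)
  obtain \<sigma> where \<sigma>: "bij_betw \<sigma> (set zs) {1..h}"
    and s\<sigma>: "\<And>u. in_out_sum (set zs) \<sigma> u = arcs_sum 0 zs u"
    using labelling_of_list[OF dzs] by (auto simp: h_def)
  have zsum: "arcs_sum 0 zs u = arcs_sum 0 xs u - arcs_sum (length xs) ys u" for u
    by (simp add: zs_def arcs_sum_append arcs_sum_swap)
  have h: "h = length xs + length ys" by (simp add: h_def zs_def)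
  have lowA: "arcs_sum 0 zs u \<ge> - int h" if "u \<in> A" for u
  proof -
    have "arcs_sum 0 xs u = 0" using xsB that AV(6) by (intro arcs_sum_eq_0) (auto simp: Field_def)
    then show ?thesis using leys[of u] by (simp add: zsum h)
  qed
  have highB: "arcs_sum 0 zs u \<le> int h" if "u \<in> insert x B" for u
  proof -
    have "arcs_sum (length xs) ys u = 0"
      using ysA(1) that AV(2,6) by (intro arcs_sum_eq_0) (auto simp: Field_def)
    then show ?thesis using lexs[of u] by (simp add: zsum h)
  qed
  have cover: "\<exists>a. (b, a) \<in> C" if "b \<in> B" for b
    using radius[of b] that sym by (auto simp: B_def C_def A_def dest: symD)
  obtain \<rho> where \<rho>: "bij_betw \<rho> X {h + 1..h + card X}"
    and injB: "inj_on (\<lambda>b. - arcs_sum 0 zs b + (\<Sum>e | e \<in> X \<and> fst e = b. int (\<rho> e))) (insert x B)"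
    and injA: "inj_on (\<lambda>a. arcs_sum 0 zs a + (\<Sum>e | e \<in> X \<and> snd e = a. int (\<rho> e))) A"
    using bipartite_labelling[of A B x C h "\<lambda>b. - arcs_sum 0 zs b" "arcs_sum 0 zs"] AV neA cover
    unfolding X_def by (auto simp: C_def)
  define D where "D = set zs \<union> X"
  define \<tau> where "\<tau> e = (if e \<in> X then \<rho> e else \<sigma> e)" for e
  have oX: "orients X (X \<union> X\<inverse>)" using AV by (auto simp: orients_def X_def C_def)
  have disj: "(EA \<union> EB) \<inter> (X \<union> X\<inverse>) = {}" using AV by (auto simp: X_def C_def EA_def EB_def)
  have "EA \<union> EB \<union> (X \<union> X\<inverse>) = E"
  proof
    show "EA \<union> EB \<union> (X \<union> X\<inverse>) \<subseteq> E"
      using sym by (auto simp: EA_def EB_def X_def C_def A_def dest: symD)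
    show "E \<subseteq> EA \<union> EB \<union> (X \<union> X\<inverse>)"
    proof clarify
      fix u v assume uv: "(u, v) \<in> E" "(u, v) \<notin> X" "(v, u) \<notin> X" "(u, v) \<notin> EB"
      then have vu: "(v, u) \<in> E" using sym by (auto dest: symD)
      have uV: "u \<in> V" "v \<in> V" using uv wf by auto
      have "u \<noteq> x" "v \<noteq> x" using uv vu by (auto simp: X_def A_def)
      then show "(u, v) \<in> EA" using uv vu uV by (auto simp: V EA_def EB_def X_def C_def)
    qed
  qed
  then have "orients D E" using orients_Un[OF ozs oX disj] by (simp add: D_def)
  moreover have zsX: "set zs \<inter> X = {}" using ozs disj by (auto simp: orients_def)
  have "bij_betw \<tau> D {1..card D}"
  proof -
    have "bij_betw \<tau> (set zs) {1..h}"
      using \<sigma> zsX by (subst bij_betw_cong[of _ _ \<sigma>]) (auto simp: \<tau>_def)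
    moreover have "bij_betw \<tau> X {h + 1..h + card X}"
      using \<rho> by (subst bij_betw_cong[of _ _ \<rho>]) (auto simp: \<tau>_def)
    ultimately have "bij_betw \<tau> D ({1..h} \<union> {h + 1..h + card X})"
      unfolding D_def by (rule bij_betw_combine) auto
    moreover have "card D = h + card X"
      unfolding D_def using zsX finX dzs by (simp add: card_Un_disjoint distinct_card h_def)
    moreover have "{1..h} \<union> {h + 1..h + card X} = {1..h + card X}" by auto
    ultimately show ?thesis by simp
  qed
  moreover have "inj_on (in_out_sum D \<tau>) V"
  proof -
    have total: "in_out_sum D \<tau> u = arcs_sum 0 zs u + in_out_sum X \<rho> u" for u
    proof -
      have "in_out_sum (set zs) \<tau> u = in_out_sum (set zs) \<sigma> u"
        "in_out_sum X \<tau> u = in_out_sum X \<rho> u"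
        using zsX by (auto intro!: in_out_sum_cong simp: \<tau>_def)
      then show ?thesis unfolding D_def using zsX finX s\<sigma> by (simp add: in_out_sum_Un)
    qed
    \<comment> \<open>the sums on the two sides in absolute value\<close>
    define P where "P u = arcs_sum 0 zs u + (\<Sum>e | e \<in> X \<and> snd e = u. int (\<rho> e))" for u
    define Q where "Q u = - arcs_sum 0 zs u + (\<Sum>e | e \<in> X \<and> fst e = u. int (\<rho> e))" for u
    have sA: "in_out_sum D \<tau> u = P u" if "u \<in> A" for u
    proof -
      have no_out: "{e. e \<in> X \<and> fst e = u} = {}" using that AV by (auto simp: X_def C_def)
      have "in_out_sum X \<rho> u = (\<Sum>e | e \<in> X \<and> snd e = u. int (\<rho> e))"
        unfolding in_out_sum_def no_out by simp
      then show ?thesis by (simp add: total P_def)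
    qed
    have sB: "in_out_sum D \<tau> u = - Q u" if "u \<in> insert x B" for u
    proof -
      have no_in: "{e. e \<in> X \<and> snd e = u} = {}" using that AV by (auto simp: X_def C_def)
      have "in_out_sum X \<rho> u = - (\<Sum>e | e \<in> X \<and> fst e = u. int (\<rho> e))"
        unfolding in_out_sum_def no_in by simp
      then show ?thesis by (simp add: total Q_def)
    qed
    have big: "(\<Sum>e | e \<in> X \<and> R e. int (\<rho> e)) > int h" if "e \<in> X" "R e" for R e
    proof -
      have "\<rho> e \<in> {h + 1..h + card X}" using \<rho> that by (auto simp: bij_betw_def)
      then have "int h < int (\<rho> e)" by simp
      also have "\<dots> \<le> (\<Sum>e | e \<in> X \<and> R e. int (\<rho> e))"
        using that finX by (intro member_le_sum) auto
      finally show ?thesis .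
    qed
    have posA: "P u > 0" if "u \<in> A" for u
      using big[of "(x, u)" "\<lambda>e. snd e = u"] lowA[OF that] that by (simp add: P_def X_def)
    have posB: "Q u > 0" if "u \<in> insert x B" for u
    proof -
      have "\<exists>a. (u, a) \<in> X" using that cover neA unfolding X_def by blast
      then obtain a where "(u, a) \<in> X" ..
      then show ?thesis using big[of "(u, a)" "\<lambda>e. fst e = u"] highB[OF that] by (simp add: Q_def)
    qed
    have "inj_on (in_out_sum D \<tau>) A" using injA sA unfolding P_def inj_on_def by simp
    moreover have "inj_on (in_out_sum D \<tau>) (insert x B)"
      using injB sB unfolding Q_def[symmetric] by (simp add: inj_on_def del: insert_iff)
    moreover have sep: "in_out_sum D \<tau> u \<noteq> in_out_sum D \<tau> v" if "u \<in> A" "v \<in> insert x B" for u v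
      using sA[OF that(1)] sB[OF that(2)] posA[OF that(1)] posB[OF that(2)] by linarith
    moreover have "in_out_sum D \<tau> ` A \<inter> in_out_sum D \<tau> ` insert x B = {}" using sep by blast
    ultimately show ?thesis unfolding V inj_on_Un by blast
  qed
  ultimately show ?thesis by blast
qed

lemma graph_dist_apath:
  assumes "\<exists>p. pre_digraph.apath G u p v"
  shows "\<exists>p. pre_digraph.apath G u p v \<and> length p = graph_dist G u v"
proof -
  have "\<exists>n p. pre_digraph.apath G u p v \<and> length p = n" using assms by metis
  then show ?thesis unfolding graph_dist_def by (rule LeastI_ex)
qed

lemma short_walk:
  assumes "pair_graph G" "pre_digraph.apath (with_proj G) u p v" "length p \<le> 2"
  shows "v = u \<or> (u, v) \<in> parcs G \<or> (\<exists>w. (u, w) \<in> parcs G \<and> (w, v) \<in> parcs G)"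
proof -
  interpret pair_graph G by fact
  have p: "awalk u p v" using assms(2) by (simp add: apath_def)
  consider "p = []" | e where "p = [e]" | e f where "p = [e, f]"
    using assms(3) by (cases p; cases "tl p") auto
  then show ?thesis using p by cases (auto simp: awalk_def)
qed

lemma exists_center:
  assumes G: "pair_graph G" and conn: "connected (with_proj G)"
    and rad: "graph_radius (with_proj G) \<le> 2"
  shows "\<exists>x \<in> pverts G. \<forall>v \<in> pverts G.
    v = x \<or> (x, v) \<in> parcs G \<or> (\<exists>w. (x, w) \<in> parcs G \<and> (w, v) \<in> parcs G)"
proof -
  interpret pair_graph G by fact
  have V: "finite (pverts G)" "pverts G \<noteq> {}"
    using pair_finite_verts conn by (auto simp: connected_def strongly_connected_def)
  let ?ecc = "\<lambda>x. MAX y\<in>pverts G. graph_dist (with_proj G) x y"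
  have "graph_radius (with_proj G) \<in> ?ecc ` pverts G"
    unfolding graph_radius_def with_proj_simps using V by (intro Min_in) auto
  then obtain x where x: "x \<in> pverts G" "?ecc x \<le> 2" using rad by auto
  have "v = x \<or> (x, v) \<in> parcs G \<or> (\<exists>w. (x, w) \<in> parcs G \<and> (w, v) \<in> parcs G)"
    if v: "v \<in> pverts G" for v
  proof -
    have "x \<rightarrow>\<^sup>*\<^bsub>mk_symmetric G\<^esub> v"
      using conn x v by (auto simp: connected_def strongly_connected_def)
    then have "\<exists>p. apath x p v"
      using reachable_mk_symmetric_eq[OF pair_sym_arcs] reachable_apath by blast
    from graph_dist_apath[OF this]
    obtain p where p: "apath x p v" "length p = graph_dist (with_proj G) x v"
      by (elim exE conjE)
    have "graph_dist (with_proj G) x v \<le> ?ecc x" using V v by (intro Max_ge) auto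
    then show ?thesis using short_walk[OF G p(1)] p(2) x(2) by simp
  qed
  then show ?thesis using x(1) by blast
qed

theorem corollary1p8:
  fixes G :: "'a pair_pre_digraph"
  assumes "pair_graph G"
    and "connected G"
    and "graph_radius G \<le> 2"
  shows "\<exists>D \<tau>. antimagic_orientation G D \<tau>"
proof -
  interpret pair_graph G by fact
  obtain x where x: "x \<in> pverts G"
    and radius: "\<And>v. v \<in> pverts G \<Longrightarrow>
      v = x \<or> (x, v) \<in> parcs G \<or> (\<exists>w. (x, w) \<in> parcs G \<and> (w, v) \<in> parcs G)"
    using exists_center[OF assms] by blast
  have "sym (parcs G)" using pair_sym_arcs by (simp add: symmetric_def)
  moreover have "irrefl (parcs G)" using pair_no_loops by (force simp: irrefl_def)
  moreover have "parcs G \<subseteq> pverts G \<times> pverts G"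
    using arc_fst_in_verts arc_snd_in_verts by force
  ultimately obtain D \<tau> where D: "orients D (parcs G)" "bij_betw \<tau> D {1..card D}"
      "inj_on (in_out_sum D \<tau>) (pverts G)"
    using antimagic_of_center[of "parcs G" "pverts G" x] radius x
      pair_finite_arcs pair_finite_verts by blast
  let ?D = "\<lparr>pverts = pverts G, parcs = D\<rparr>"
  have "orientation_of ?D G" using D(1) unfolding orients_def orientation_of_def by auto
  moreover have "antimagic_labeling (with_proj ?D) \<tau>"
    using D(2,3) by (auto simp: antimagic_labeling_def vertex_sum_pair inj_on_def)
  ultimately have "antimagic_orientation G ?D \<tau>" by (simp add: antimagic_orientation_def)
  then show ?thesis by blast
qed

end
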